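(* For packed words $u$ of length $k\ge1$ and $v$ of length $l\ge1$, $$\mathbf{M}_u\#\mathbf{M}_v=\sum_{w\in[u\wedge v,\ u\vee v]}\mathbf{M}_w,$$ where the interval is taken among packed words of length $k+l-1$ for the pseudo-permutohedron order.
   Context: Let $A=\{a_1<a_2<\cdots\}$ be an infinite totally ordered alphabet (identified with $\{1<2<\cdots\}$) and $\mathbb{K}$ a field; work with formal $\mathbb{K}$-linear combinations of nonempty words over $A$. The $\#$ product of words is $(ux)\#(yv)=uxv$ if the letters $x,y$ are equal and $0$ otherwise ($u,v$ words, $x,y$ letters), extended bilinearly. For a word $w$ whose distinct letters are $b_1<\dots<b_r$, $\mathrm{pack}(w)$ is the image of $w$ under $b_i\mapsto i$; $w$ is packed if $\mathrm{pack}(w)=w$. For a packed word $u$, $\mathbf{M}_u=\sum_{\mathrm{pack}(w)=u}w$. For a packed word $w$ of length $n$ and $1\le i<j\le n$, the pair $(i,j)$ has coefficient $1$ if $w_i>w_j$, $1/2$ if $w_i=w_j$, and $0$ if $w_i<w_j$. For packed words $u,v$ of the same length, $u\le v$ in the pseudo-permutohedron order iff the coefficient of every pair $(i,j)$ in $u$ is at most its coefficient in $v$. For packed words $\alpha$ of length $k$ and $\beta$ of length $l$, $\alpha\vee\beta$ is the word obtained by writing, for $i=1,\dots,k$, $\alpha_i+\beta_1-1$ if $\alpha_i\le\alpha_k$ and $\alpha_i+\max(\beta)-1$ if $\alpha_i>\alpha_k$; then for $i=2,\dots,l$, $\beta_i$ if $\beta_i<\beta_1$ and $\beta_i+\alpha_k-1$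 if $\beta_i\ge\beta_1$. The word $\alpha\wedge\beta$ is obtained by writing, for $i=1,\dots,k$, $\alpha_i$ if $\alpha_i<\alpha_k$ and $\alpha_i+\beta_1-1$ if $\alpha_i\ge\alpha_k$; then for $i=2,\dots,l$, $\beta_i+\alpha_k-1$ if $\beta_i\le\beta_1$ and $\beta_i+\max(\alpha)-1$ if $\beta_i>\beta_1$. *)

theory Defs
  imports Complex_Main "HOL-Library.Function_Algebras"
begin

text \<open>
  The alphabet is the set of positive natural numbers with its usual order, and a word is a
  nonempty list of letters. A formal (possibly infinite) linear combination of words is its
  coefficient function; only the values at words matter. Addition and zero are pointwise
  (Function_Algebras).
\<close>

type_synonym 'k series = "nat list \<Rightarrow> 'k"

definition is_word :: "nat list \<Rightarrow> bool" where
  "is_word w \<longleftrightarrow> w \<noteq> [] \<and> 0 \<notin> set w"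

definition single :: "nat list \<Rightarrow> 'k::field series" where
  "single w = (\<lambda>x. if x = w then 1 else 0)"

text \<open>\<open>p = ux\<close> and \<open>q = yv\<close>, so \<open>uxv = p @ tl q\<close>.\<close>

definition word_sharp :: "nat list \<Rightarrow> nat list \<Rightarrow> 'k::field series" where
  "word_sharp p q = (if last p = hd q then single (p @ tl q) else 0)"

text \<open>
  Bilinear extension to infinite combinations: the coefficient of \<open>w\<close> in the product is the sum of
  \<open>F p * G q\<close> times the coefficient of \<open>w\<close> in \<open>word_sharp p q\<close>. Only finitely many
  pairs contribute to a given \<open>w\<close>, see \<open>finite_sharp_support\<close>.
\<close>

definition sharp :: "'k::field series \<Rightarrow> 'k series \<Rightarrow> 'k series"  (infixl "\<sharp>" 70) where
  "F \<sharp> G = (\<lambda>w. \<Sum>(p, q) \<in> {(p, q). is_word p \<and> is_word q \<and> word_sharp p q w \<noteq> (0::'k)}.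
      F p * G q * word_sharp p q w)"

lemma finite_sharp_support:
  "finite {(p, q). is_word p \<and> is_word q \<and> word_sharp p q w \<noteq> (0::'k::field)}"
proof (rule finite_subset)
  show "{(p, q). is_word p \<and> is_word q \<and> word_sharp p q w \<noteq> (0::'k)}
      \<subseteq> (\<lambda>i. (take i w, drop (i - 1) w)) ` {..length w}"
  proof clarify
    fix p q
    assume p: "is_word p" and q: "is_word q" and "word_sharp p q w \<noteq> (0::'k)"
    then have eq: "last p = hd q" "w = p @ tl q"
      by (auto simp: word_sharp_def single_def split: if_splits)
    have "p = butlast p @ [last p]" "q = hd q # tl q"
      using p q by (simp_all add: is_word_def)
    with eq have "w = butlast p @ q"
      by (metis append.assoc append_Cons append_Nil)
    then have "drop (length p - 1) w = q"
      by simp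
    with eq show "(p, q) \<in> (\<lambda>i. (take i w, drop (i - 1) w)) ` {..length w}"
      by (intro image_eqI[of _ _ "length p"]) auto
  qed
qed simp

lemma sharp_single:
  assumes "is_word p" "is_word q"
  shows "single p \<sharp> single q = (word_sharp p q :: 'k::field series)"
proof
  fix w
  let ?S = "{(p, q). is_word p \<and> is_word q \<and> word_sharp p q w \<noteq> (0::'k)}"
  have "(single p \<sharp> single q) w
      = (\<Sum>z\<in>?S. if z = (p, q) then word_sharp p q w else (0::'k))"
    unfolding sharp_def by (rule sum.cong) (auto simp: single_def split: if_splits)
  also have "\<dots> = word_sharp p q w"
    using assms by (subst sum.delta[OF finite_sharp_support]) auto
  finally show "(single p \<sharp> single q) w = (word_sharp p q w :: 'k)" .
qed

text \<open>The \<open>i\<close>-th smallest letter of \<open>w\<close> is the one with exactly \<open>i\<close> letters of \<open>w\<close> below or equal.\<close>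

definition pack :: "nat list \<Rightarrow> nat list" where
  "pack w = map (\<lambda>b. card {c \<in> set w. c \<le> b}) w"

definition packed :: "nat list \<Rightarrow> bool" where
  "packed w \<longleftrightarrow> pack w = w"

definition M :: "nat list \<Rightarrow> 'k::field series" where
  "M u = (\<lambda>w. if is_word w \<and> pack w = u then 1 else 0)"

text \<open>Positions are numbered from 0.\<close>

definition pair_coeff :: "nat list \<Rightarrow> nat \<Rightarrow> nat \<Rightarrow> rat" where
  "pair_coeff w i j = (if w ! i > w ! j then 1 else if w ! i = w ! j then 1/2 else 0)"

definition pp_le :: "nat list \<Rightarrow> nat list \<Rightarrow> bool" where
  "pp_le u v \<longleftrightarrow> length u = length v \<and>
     (\<forall>i j. i < j \<and> j < length u \<longrightarrow> pair_coeff u i j \<le> pair_coeff v i j)"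

definition pp_interval :: "nat \<Rightarrow> nat list \<Rightarrow> nat list \<Rightarrow> nat list set" where
  "pp_interval n a b = {w. packed w \<and> length w = n \<and> pp_le a w \<and> pp_le w b}"

lemma finite_pp_interval: "finite (pp_interval n a b)"
proof (rule finite_subset)
  have "set w \<subseteq> {..length w}" if "pack w = w" for w
  proof
    fix x assume "x \<in> set w"
    then have "x \<in> set (pack w)" using that by simp
    then obtain b where "x = card {c \<in> set w. c \<le> b}"
      by (auto simp: pack_def)
    also have "\<dots> \<le> card (set w)" by (rule card_mono) auto
    also have "\<dots> \<le> length w" by (rule card_length)
    finally show "x \<in> {..length w}" by simp
  qed
  then show "pp_interval n a b \<subseteq> {w. set w \<subseteq> {..n} \<and> length w = n}"
    by (auto simp: pp_interval_def packed_def)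
  show "finite {w. set w \<subseteq> {..n} \<and> length w = n}"
    by (rule finite_lists_length_eq) simp
qed

text \<open>
  The letters of packed words are at least 1, so the truncated subtractions below are exact.
\<close>

definition vee :: "nat list \<Rightarrow> nat list \<Rightarrow> nat list" where
  "vee \<alpha> \<beta> =
     map (\<lambda>a. if a \<le> last \<alpha> then a + hd \<beta> - 1 else a + Max (set \<beta>) - 1) \<alpha> @
     map (\<lambda>b. if b < hd \<beta> then b else b + last \<alpha> - 1) (tl \<beta>)"

definition wedge :: "nat list \<Rightarrow> nat list \<Rightarrow> nat list" where
  "wedge \<alpha> \<beta> =
     map (\<lambda>a. if a < last \<alpha> then a else a + hd \<beta> - 1) \<alpha> @
     map (\<lambda>b. if b \<le> hd \<beta> then b + last \<alpha> - 1 else b + Max (set \<alpha>) - 1) (tl \<beta>)"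

end

theory Submission
  imports Defs
begin

text \<open>
  \<open>pack w\<close> records exactly the relative order of the letters of \<open>w\<close>, so a word \<open>w\<close> occurs in
  \<open>M u \<sharp> M v\<close> iff its first \<open>k\<close> letters are ordered as \<open>u\<close> and its last \<open>l\<close> letters as \<open>v\<close>.
  Both \<open>wedge u v\<close> and \<open>vee u v\<close> satisfy this, so a word between them does too. Conversely,
  for a letter of the first part and a letter of the last part, comparing each of them with the
  shared letter either determines their relative order, and then \<open>wedge u v\<close> and \<open>vee u v\<close> agree
  on that pair, or leaves it free, and then they have coefficients 0 and 1 there.
\<close>

section \<open>Relative order of letters and packing\<close>

definition same_order :: "nat list \<Rightarrow> nat list \<Rightarrow> bool" where
  "same_order xs ys \<longleftrightarrow> length xs = length ys \<and>
     (\<forall>i<length xs. \<forall>j<length xs. xs ! i < xs ! j \<longleftrightarrow> ys ! i < ys ! j)"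

lemma same_order_sym: "same_order xs ys \<Longrightarrow> same_order ys xs"
  by (auto simp: same_order_def)

lemma same_order_trans: "same_order xs ys \<Longrightarrow> same_order ys zs \<Longrightarrow> same_order xs zs"
  by (auto simp: same_order_def)

lemma same_order_le:
  assumes "same_order xs ys" "i < length xs" "j < length xs"
  shows "xs ! i \<le> xs ! j \<longleftrightarrow> ys ! i \<le> ys ! j"
  using assms by (meson linorder_not_less same_order_def)

lemma length_pack [simp]: "length (pack w) = length w"
  by (simp add: pack_def)

text \<open>Counting the letters below or equal is strictly increasing on \<open>set w\<close>: for
  \<open>a < b\<close> the letter \<open>b\<close> itself is counted for \<open>b\<close> but not
  for \<open>a\<close>.\<close>

lemma same_order_pack: "same_order (pack w) w"
proof -
  have "card {c \<in> set w. c \<le> a} < card {c \<in> set w. c \<le> b} \<longleftrightarrow> a < b" if "b \<in> set w" for a b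
  proof
    assume "a < b"
    then show "card {c \<in> set w. c \<le> a} < card {c \<in> set w. c \<le> b}"
      using that by (intro psubset_card_mono) (auto simp: psubset_eq set_eq_iff intro!: exI[of _ b])
  next
    assume *: "card {c \<in> set w. c \<le> a} < card {c \<in> set w. c \<le> b}"
    show "a < b"
    proof (rule ccontr)
      assume "\<not> a < b"
      then have "card {c \<in> set w. c \<le> b} \<le> card {c \<in> set w. c \<le> a}"
        by (intro card_mono) auto
      with * show False by simp
    qed
  qed
  then show ?thesis
    by (auto simp: same_order_def pack_def)
qed

text \<open>On \<open>A\<close> the map \<open>g\<close> factors through \<open>f\<close>, so
  \<open>g\<close> A\<open>is an image of\<close>f \<open>A\<close>. Used in both directions, this
  compares numbers of distinct letters without a bijection between them.\<close>

lemma card_image_le_of_kernel: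
  assumes "finite A" "\<And>x y. x \<in> A \<Longrightarrow> y \<in> A \<Longrightarrow> f x = f y \<Longrightarrow> g x = g y"
  shows "card (g ` A) \<le> card (f ` A)"
proof -
  have "g ` A \<subseteq> (\<lambda>z. g (inv_into A f z)) ` f ` A"
  proof
    fix z assume "z \<in> g ` A"
    then obtain x where x: "x \<in> A" "z = g x" by blast
    have "g (inv_into A f (f x)) = g x"
      using x by (intro assms(2)) (auto intro: inv_into_into f_inv_into_f)
    then show "z \<in> (\<lambda>z. g (inv_into A f z)) ` f ` A"
      using x by (metis image_eqI)
  qed
  then have "card (g ` A) \<le> card ((\<lambda>z. g (inv_into A f z)) ` f ` A)"
    using assms(1) by (intro card_mono) auto
  also have "\<dots> \<le> card (f ` A)"
    using assms(1) by (intro card_image_le) auto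
  finally show ?thesis .
qed

text \<open>The letter of \<open>pack xs\<close> at position \<open>i\<close> is the number of
  distinct letters at the positions in \<open>A\<close>. Both \<open>A\<close> and the coincidences
  between letters at these positions depend only on the relative order.\<close>

lemma pack_eq_iff_same_order: "pack xs = pack ys \<longleftrightarrow> same_order xs ys"
proof
  assume "pack xs = pack ys"
  then show "same_order xs ys"
    by (metis same_order_pack same_order_sym same_order_trans)
next
  assume so: "same_order xs ys"
  then have len: "length xs = length ys" by (simp add: same_order_def)
  show "pack xs = pack ys"
  proof (rule nth_equalityI)
    fix i assume "i < length (pack xs)"
    then have i: "i < length xs" by simp
    define A where "A = {j. j < length xs \<and> xs ! j \<le> xs ! i}"
    have A': "A = {j. j < length ys \<and> ys ! j \<le> ys ! i}"
      unfolding A_def using same_order_le[OF so] i len by auto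
    have 1: "{c \<in> set xs. c \<le> xs ! i} = (!) xs ` A"
      by (auto simp: A_def in_set_conv_nth)
    have 2: "{c \<in> set ys. c \<le> ys ! i} = (!) ys ` A"
      by (auto simp: A' in_set_conv_nth)
    have ker: "xs ! j = xs ! j' \<longleftrightarrow> ys ! j = ys ! j'" if "j \<in> A" "j' \<in> A" for j j'
      using that same_order_le[OF so, of j j'] same_order_le[OF so, of j' j]
      by (auto simp: A_def eq_iff)
    have "finite A" by (simp add: A_def)
    then have "card ((!) xs ` A) = card ((!) ys ` A)"
      using ker by (intro le_antisym; intro card_image_le_of_kernel) simp_all
    then show "pack xs ! i = pack ys ! i"
      using i len 1 2 by (simp add: pack_def)
  qed (simp add: len)
qed

lemma packed_pack: "packed (pack w)"
  by (simp add: packed_def pack_eq_iff_same_order same_order_pack)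

lemma packed_eq_iff: "packed u \<Longrightarrow> pack w = u \<longleftrightarrow> same_order w u"
  by (metis packed_def pack_eq_iff_same_order)

lemma packed_ge_1: "packed w \<Longrightarrow> a \<in> set w \<Longrightarrow> 1 \<le> a"
proof -
  assume "packed w" "a \<in> set w"
  then have "a \<in> set (pack w)" by (simp add: packed_def)
  then obtain b where "b \<in> set w" "a = card {c \<in> set w. c \<le> b}"
    by (auto simp: pack_def)
  then show ?thesis by (auto simp: Suc_le_eq card_gt_0_iff)
qed

section \<open>The pseudo-permutohedron order in terms of inequalities between letters\<close>

lemma pair_coeff_le_iff:
  "pair_coeff x i j \<le> pair_coeff y i j \<longleftrightarrow>
     (x ! j < x ! i \<longrightarrow> y ! j < y ! i) \<and> (x ! j \<le> x ! i \<longrightarrow> y ! j \<le> y ! i)"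
  by (auto simp: pair_coeff_def)

text \<open>A coefficient is 1 exactly at a strict descent and at least 1/2 exactly at a weak one,
  so the order says that descents of both kinds persist.\<close>

lemma pp_le_alt:
  "pp_le x y \<longleftrightarrow> length x = length y \<and> (\<forall>i j. i < j \<and> j < length x \<longrightarrow>
     (x ! j < x ! i \<longrightarrow> y ! j < y ! i) \<and> (x ! j \<le> x ! i \<longrightarrow> y ! j \<le> y ! i))"
  by (simp add: pp_le_def pair_coeff_le_iff)

lemma same_order_pair_coeff:
  assumes "same_order x y" "i < length x" "j < length x"
  shows "pair_coeff x i j = pair_coeff y i j"
  using assms same_order_le[OF assms(1)] by (intro antisym) (auto simp: pair_coeff_le_iff same_order_def)

lemma pp_le_pack: "pp_le a (pack w) \<longleftrightarrow> pp_le a w" "pp_le (pack w) a \<longleftrightarrow> pp_le w a"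
  using same_order_pair_coeff[OF same_order_pack, of _ w] by (auto simp: pp_le_def)

lemma same_order_take_iff:
  assumes "length x = m"
  shows "same_order (take m w) x \<longleftrightarrow>
    m \<le> length w \<and> (\<forall>i<m. \<forall>j<m. w ! i < w ! j \<longleftrightarrow> x ! i < x ! j)"
  using assms by (auto simp: same_order_def min_def)

lemma same_order_drop_iff:
  assumes "length x = length w - m"
  shows "same_order (drop m w) x \<longleftrightarrow>
    (\<forall>i<length x. \<forall>j<length x. w ! (m + i) < w ! (m + j) \<longleftrightarrow> x ! i < x ! j)"
  using assms by (auto simp: same_order_def)

text \<open>On the factor starting at \<open>d\<close>, the words \<open>a\<close> and
  \<open>b\<close> have equal coefficients, which squeezes those of \<open>w\<close>. The form
  \<open>take m (drop d _)\<close> serves both for the prefix and for the suffix.\<close>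

lemma pp_between_same_order:
  assumes "pp_le a w" "pp_le w b" "same_order (take m (drop d a)) x" "same_order (take m (drop d b)) x"
  shows "same_order (take m (drop d w)) x"
proof -
  let ?s = "\<lambda>y. take m (drop d y)"
  have len: "length a = length w" "length b = length w"
    using assms(1,2) by (simp_all add: pp_le_def)
  have sub: "pp_le (?s y) (?s z)" if "pp_le y z" for y z
    using that by (auto simp: pp_le_alt)
  have aw: "pp_le (?s a) (?s w)" and wb: "pp_le (?s w) (?s b)"
    using assms(1,2) sub by auto
  have ab: "same_order (?s a) (?s b)"
    using assms(3,4) same_order_sym same_order_trans by blast
  have "?s a ! i < ?s a ! j \<longleftrightarrow> ?s w ! i < ?s w ! j"
    if "i < length (?s a)" "j < length (?s a)" for i j
  proof -
    have "pair_coeff (?s a) p q = pair_coeff (?s w) p q" if "p < q" "q < length (?s a)" for p q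
    proof (rule antisym)
      show "pair_coeff (?s a) p q \<le> pair_coeff (?s w) p q"
        using aw that by (auto simp: pp_le_def)
      have "pair_coeff (?s w) p q \<le> pair_coeff (?s b) p q"
        using wb that len by (auto simp: pp_le_def)
      also have "\<dots> = pair_coeff (?s a) p q"
        using same_order_pair_coeff[OF ab, of p q] that by simp
      finally show "pair_coeff (?s w) p q \<le> pair_coeff (?s a) p q" .
    qed
    \<comment> \<open>A coefficient for \<open>p < q\<close> fixes the comparison of the two letters
      completely, hence in both directions.\<close>
    from this[of i j] this[of j i] that show ?thesis
      by (cases i j rule: linorder_cases) (auto simp: pair_coeff_def split: if_splits)
  qed
  then have "same_order (?s w) (?s a)"
    using len by (auto simp: same_order_def)
  then show ?thesis
    using assms(3) same_order_trans by blast
qed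

section \<open>The interval between \<open>wedge u v\<close> and \<open>vee u v\<close>\<close>

locale packed_pair =
  fixes u v :: "nat list"
  assumes packed_u: "packed u" and packed_v: "packed v" and u_ne: "u \<noteq> []" and v_ne: "v \<noteq> []"
begin

text \<open>Position of the letter shared by the two factors.\<close>

definition "d = length u - 1"

definition "max_u = Max (set u)"

definition "max_v = Max (set v)"

lemma u_ge_1: "i < length u \<Longrightarrow> 1 \<le> u ! i"
  using packed_ge_1[OF packed_u] by simp

lemma v_ge_1: "j < length v \<Longrightarrow> 1 \<le> v ! j"
  using packed_ge_1[OF packed_v] by simp

lemma u_le_Max: "i < length u \<Longrightarrow> u ! i \<le> max_u"
  by (simp add: max_u_def)

lemma v_le_Max: "j < length v \<Longrightarrow> v ! j \<le> max_v"
  by (simp add: max_v_def)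

lemma lengths: "d < length u" "0 < length v"
  using u_ne v_ne by (simp_all add: d_def)

lemma length_u: "length u = Suc d"
  using u_ne by (simp add: d_def)

lemma last_u: "last u = u ! d"
  using u_ne by (simp add: last_conv_nth d_def)

lemma hd_v: "hd v = v ! 0"
  using v_ne by (simp add: hd_conv_nth)

lemma length_vee: "length (vee u v) = length u + length v - 1"
  using v_ne by (cases v) (simp_all add: vee_def)

lemma length_wedge: "length (wedge u v) = length u + length v - 1"
  using v_ne by (cases v) (simp_all add: wedge_def)

lemma vee_nth_left:
  "i < length u \<Longrightarrow>
    vee u v ! i = (if u ! i \<le> u ! d then u ! i + v ! 0 - 1 else u ! i + max_v - 1)"
  by (simp add: vee_def max_v_def nth_append last_u hd_v)

lemma wedge_nth_left:
  "i < length u \<Longrightarrow> wedge u v ! i = (if u ! i < u ! d then u ! i else u ! i + v ! 0 - 1)"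
  by (simp add: wedge_def nth_append last_u hd_v)

text \<open>The case \<open>j = 0\<close> is the shared letter: it is written by the left part, but
  the formula for the right part gives the same value there. Thus the right part can be treated as a
  full copy of \<open>v\<close> starting at \<open>d\<close>.\<close>

lemma vee_nth_right:
  assumes "j < length v"
  shows "vee u v ! (d + j) = (if v ! j < v ! 0 then v ! j else v ! j + u ! d - 1)"
proof (cases j)
  case 0
  then show ?thesis using lengths by (simp add: vee_nth_left add.commute)
next
  case (Suc m)
  then have "d + j = length u + m" by (simp add: length_u)
  moreover have "tl v ! m = v ! j" using Suc assms by (simp add: nth_tl)
  moreover have "m < length (tl v)" using Suc assms by simp
  ultimately show ?thesis
    by (simp add: vee_def nth_append last_u hd_v)
qed

lemma wedge_nth_right:
  assumes "j < length v"
  shows "wedge u v ! (d + j) = (if v ! j \<le> v ! 0 then v ! j + u ! d - 1 else v ! j + max_u - 1)"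
proof (cases j)
  case 0
  then show ?thesis using lengths by (simp add: wedge_nth_left add.commute)
next
  case (Suc m)
  then have "d + j = length u + m" by (simp add: length_u)
  moreover have "tl v ! m = v ! j" using Suc assms by (simp add: nth_tl)
  moreover have "m < length (tl v)" using Suc assms by simp
  ultimately show ?thesis
    by (simp add: wedge_def nth_append last_u hd_v max_u_def)
qed

lemma length_u_le: "length u \<le> length u + length v - 1"
  using lengths(2) by linarith

text \<open>The shift added to a letter never decreases as the letter grows, because
  \<open>v ! 0 \<le> max_v\<close>; such a shift keeps strict and weak comparisons. The next three
  lemmas rest on the same principle.\<close>

lemma same_order_vee_left: "same_order (take (length u) (vee u v)) u"
  unfolding same_order_take_iff[OF refl] length_vee
  using v_le_Max[OF lengths(2)] v_ge_1[OF lengths(2)] length_u_le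
  by (auto simp: vee_nth_left)

lemma same_order_wedge_left: "same_order (take (length u) (wedge u v)) u"
  unfolding same_order_take_iff[OF refl] length_wedge
  using v_ge_1[OF lengths(2)] length_u_le
  by (auto simp: wedge_nth_left)

lemma same_order_vee_right: "same_order (drop d (vee u v)) v"
proof (subst same_order_drop_iff)
  show "length v = length (vee u v) - d" by (simp add: length_vee length_u)
qed (use u_ge_1[OF lengths(1)] in \<open>auto simp: vee_nth_right\<close>)

lemma same_order_wedge_right: "same_order (drop d (wedge u v)) v"
proof (subst same_order_drop_iff)
  show "length v = length (wedge u v) - d" by (simp add: length_wedge length_u)
qed (use u_ge_1[OF lengths(1)] u_le_Max[OF lengths(1)] v_ge_1 in \<open>auto simp: wedge_nth_right\<close>)

text \<open>Left letters above \<open>u ! d\<close> become at least \<open>u ! d + max_v\<close>,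
  beyond every right letter, and right letters below \<open>v ! 0\<close> stay below every left
  letter. In the remaining case \<open>u ! d + v ! 0 - 1\<close> separates the two.\<close>

lemma vee_cross:
  assumes "i < length u" "j < length v"
  shows "vee u v ! (d + j) < vee u v ! i \<longleftrightarrow> u ! d < u ! i \<or> v ! j < v ! 0"
    and "vee u v ! (d + j) \<le> vee u v ! i \<longleftrightarrow>
      u ! d < u ! i \<or> v ! j < v ! 0 \<or> u ! i = u ! d \<and> v ! j = v ! 0"
  using u_ge_1[OF assms(1)] u_ge_1[OF lengths(1)] v_ge_1[OF assms(2)] v_ge_1[OF lengths(2)]
    v_le_Max[OF assms(2)] v_le_Max[OF lengths(2)]
  by (auto simp: vee_nth_left[OF assms(1)] vee_nth_right[OF assms(2)])

text \<open>Dually, left letters below \<open>u ! d\<close> are unchanged while right letters are at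
  least \<open>u ! d\<close>; right letters above \<open>v ! 0\<close> become at least
  \<open>v ! 0 + max_u\<close>, beyond every left letter.\<close>

lemma wedge_cross:
  assumes "i < length u" "j < length v"
  shows "wedge u v ! (d + j) < wedge u v ! i \<longleftrightarrow>
      u ! d \<le> u ! i \<and> v ! j \<le> v ! 0 \<and> (u ! d < u ! i \<or> v ! j < v ! 0)"
    and "wedge u v ! (d + j) \<le> wedge u v ! i \<longleftrightarrow> u ! d \<le> u ! i \<and> v ! j \<le> v ! 0"
  using u_ge_1[OF assms(1)] u_ge_1[OF lengths(1)] v_ge_1[OF assms(2)] v_ge_1[OF lengths(2)]
    u_le_Max[OF assms(1)] u_le_Max[OF lengths(1)]
  by (auto simp: wedge_nth_left[OF assms(1)] wedge_nth_right[OF assms(2)])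

lemma position_cases:
  assumes "i < j" "j < length u + length v - 1"
  obtains (left) "i < length u" "j < length u"
  | (right) i' j' where "i = d + i'" "j = d + j'" "i' < length v" "j' < length v"
  | (cross) j' where "i < length u" "j = d + j'" "j' < length v"
proof (cases "j < length u")
  case True
  then show ?thesis using left assms by simp
next
  case False
  then have "j = d + (j - d)" "j - d < length v" using assms by (auto simp: length_u)
  moreover have "i < length u \<or> i = d + (i - d) \<and> i - d < length v" using assms by (auto simp: length_u)
  ultimately show ?thesis using right cross by blast
qed

lemma pp_between_iff:
  "pp_le (wedge u v) w \<and> pp_le w (vee u v) \<longleftrightarrow>
    length w = length u + length v - 1 \<and>
    same_order (take (length u) w) u \<and> same_order (drop d w) v" (is "?L \<longleftrightarrow> ?R")
proof
  assume L: ?L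
  then have len: "length w = length u + length v - 1"
    using length_vee by (simp add: pp_le_def)
  have "same_order (take (length u) w) u"
    using pp_between_same_order[of "wedge u v" w "vee u v" "length u" 0 u] L
      same_order_vee_left same_order_wedge_left by simp
  moreover have "same_order (drop d w) v"
    \<comment> \<open>With \<open>m = length w\<close> the \<open>take\<close> is vacuous, leaving
      the whole suffix from \<open>d\<close>.\<close>
    using pp_between_same_order[of "wedge u v" w "vee u v" "length w" d v] L len length_vee
      length_wedge same_order_vee_right same_order_wedge_right by simp
  ultimately show ?R using len by simp
next
  assume R: ?R
  then have len: "length w = length u + length v - 1"
    and wleft: "\<And>i j. i < length u \<Longrightarrow> j < length u \<Longrightarrow> w ! i < w ! j \<longleftrightarrow> u ! i < u ! j"
    by (auto simp: same_order_take_iff)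
  have len': "length v = length x - d" if "length x = length u + length v - 1" for x :: "nat list"
    using that by (simp add: length_u)
  have wright: "\<And>i j. i < length v \<Longrightarrow> j < length v \<Longrightarrow> w ! (d + i) < w ! (d + j) \<longleftrightarrow> v ! i < v ! j"
    using R unfolding same_order_drop_iff[OF len'[OF len]] by blast
  have vl: "\<And>i j. i < length u \<Longrightarrow> j < length u \<Longrightarrow> vee u v ! i < vee u v ! j \<longleftrightarrow> u ! i < u ! j"
    and wl: "\<And>i j. i < length u \<Longrightarrow> j < length u \<Longrightarrow> wedge u v ! i < wedge u v ! j \<longleftrightarrow> u ! i < u ! j"
    using same_order_vee_left same_order_wedge_left by (auto simp: same_order_take_iff)
  have vr: "\<And>i j. i < length v \<Longrightarrow> j < length v \<Longrightarrow>
      vee u v ! (d + i) < vee u v ! (d + j) \<longleftrightarrow> v ! i < v ! j"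
    using same_order_vee_right unfolding same_order_drop_iff[OF len'[OF length_vee]] by blast
  have wr: "\<And>i j. i < length v \<Longrightarrow> j < length v \<Longrightarrow>
      wedge u v ! (d + i) < wedge u v ! (d + j) \<longleftrightarrow> v ! i < v ! j"
    using same_order_wedge_right unfolding same_order_drop_iff[OF len'[OF length_wedge]] by blast
  have "pair_coeff (wedge u v) i j \<le> pair_coeff w i j \<and> pair_coeff w i j \<le> pair_coeff (vee u v) i j"
    if "i < j" "j < length u + length v - 1" for i j
    using that
  proof (cases rule: position_cases)
    case left
    then show ?thesis
      using wleft[OF left] wleft[OF left(2,1)] vl[OF left] vl[OF left(2,1)]
        wl[OF left] wl[OF left(2,1)]
      unfolding pair_coeff_le_iff by (smt (verit) linorder_not_less)
  next
    case (right i' j')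
    then show ?thesis
      using wright[OF right(3,4)] wright[OF right(4,3)] vr[OF right(3,4)] vr[OF right(4,3)]
        wr[OF right(3,4)] wr[OF right(4,3)]
      unfolding pair_coeff_le_iff right(1,2) by (smt (verit) linorder_not_less)
  next
    case (cross j')
    \<comment> \<open>Both letters are compared with the shared letter \<open>w ! d\<close>, once
      through \<open>u\<close> and once through \<open>v\<close>.\<close>
    have "w ! i < w ! d \<longleftrightarrow> u ! i < u ! d" "w ! d < w ! i \<longleftrightarrow> u ! d < u ! i"
      using wleft cross lengths by blast+
    moreover have "w ! d < w ! j \<longleftrightarrow> v ! 0 < v ! j'" "w ! j < w ! d \<longleftrightarrow> v ! j' < v ! 0"
      using wright[of 0 j'] wright[of j' 0] cross lengths by simp_all
    ultimately show ?thesis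
      \<comment> \<open>Of the nine combinations, seven fix the comparison by transitivity. The two
        free ones have both letters strictly above or both strictly below the shared letter.\<close>
      unfolding pair_coeff_le_iff cross(2) vee_cross[OF cross(1,3)] wedge_cross[OF cross(1,3)]
      by (cases "u ! i" "u ! d" rule: linorder_cases;
          cases "v ! j'" "v ! 0" rule: linorder_cases) simp_all
  qed
  then show ?L
    using len length_vee length_wedge by (simp add: pp_le_def)
qed

end

section \<open>Coefficients of the product\<close>

lemma word_sharp_eq_single:
  "word_sharp p q w = (if last p = hd q \<and> w = p @ tl q then 1 else 0 :: 'k::field)"
  by (simp add: word_sharp_def single_def)

text \<open>A pair contributing to \<open>w\<close> is a cut of \<open>w\<close> at a letter kept on
  both sides, hence determined by the length of its left factor. As \<open>pack\<close> preserves
  length, only the cut \<open>pq\<close> can give a nonzero term.\<close>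

lemma M_sharp_M_apply:
  assumes "u \<noteq> []" "v \<noteq> []"
  shows "(M u \<sharp> M v) w = (if is_word w \<and> length w = length u + length v - 1 \<and>
      pack (take (length u) w) = u \<and> pack (drop (length u - 1) w) = v then 1 else 0 :: 'k::field)"
    (is "_ = (if ?P then _ else _)")
proof -
  define pq where "pq = (take (length u) w, drop (length u - 1) w)"
  let ?S = "{(p, q). is_word p \<and> is_word q \<and> word_sharp p q w \<noteq> (0::'k)}"
  have term_eq: "(case z of (p, q) \<Rightarrow> M u p * M v q * word_sharp p q w) =
      (if z = pq then if ?P then 1 else 0 else (0::'k))" if "z \<in> ?S" for z
  proof -
    obtain p q where z: "z = (p, q)" by (cases z)
    with that have pw: "is_word p" "is_word q" "last p = hd q" and w: "w = p @ tl q"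
      by (auto simp: word_sharp_eq_single split: if_splits)
    \<comment> \<open>Counting the shared letter with \<open>q\<close> instead of \<open>p\<close>
      exhibits \<open>q\<close> as a suffix of \<open>w\<close>.\<close>
    have w': "w = butlast p @ q"
      using pw w by (metis append.assoc append_Cons append_Nil append_butlast_last_id is_word_def
          list.collapse)
    have word: "is_word w"
      using pw w by (auto simp: is_word_def dest: list.set_sel(2))
    have lw: "length w = length p + length q - 1"
      using pw w by (cases q) (auto simp: is_word_def)
    have eq: "z = pq \<longleftrightarrow> length p = length u"
    proof
      assume "z = pq"
      then have "p = take (length u) w" "q = drop (length u - 1) w" using z pq_def by auto
      then have "length q = length w - (length u - 1)" by simp
      \<comment> \<open>Since \<open>q\<close> is nonempty, the subtraction giving its length is not
        truncated.\<close>
      moreover have "0 < length u" "0 < length p" "0 < length q"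
        using assms pw by (simp_all add: is_word_def)
      ultimately show "length p = length u"
        using lw by linarith
    next
      assume l: "length p = length u"
      have "drop (length u - 1) w = q"
        using l by (simp add: w')
      moreover have "take (length u) w = p" using l by (simp add: w)
      ultimately show "z = pq" by (simp add: z pq_def)
    qed
    have coeff: "word_sharp p q w = (1::'k)"
      using pw w by (simp add: word_sharp_eq_single)
    show ?thesis
    proof (cases "z = pq")
      case True
      then have "p = take (length u) w" "q = drop (length u - 1) w" using z pq_def by auto
      moreover have "length w = length u + length v - 1" if "pack q = v"
        using that lw eq True by auto
      ultimately have "?P \<longleftrightarrow> pack p = u \<and> pack q = v"
        using word by metis
      then show ?thesis
        using True pw coeff by (auto simp: z M_def)
    next
      case False
      then have "pack p \<noteq> u" using eq by (metis length_pack)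
      then show ?thesis using False by (simp add: z M_def)
    qed
  qed
  have mem: "pq \<in> ?S" if P: ?P
  proof -
    obtain n where n: "length u = Suc n"
      using assms by (cases u) auto
    have nz: "0 \<notin> set w" and lw: "length w = length u + length v - 1"
      using P unfolding is_word_def by blast+
    \<comment> \<open>Since \<open>v\<close> is nonempty, the cut position lies inside
      \<open>w\<close>, so both factors are nonempty and share \<open>w ! n\<close>.\<close>
    have nw: "n < length w"
      using lw n assms(2) by (cases v) simp_all
    have "0 \<notin> set (take (length u) w)" "0 \<notin> set (drop (length u - 1) w)"
      using nz by (meson in_set_takeD in_set_dropD)+
    then have "is_word (fst pq)" "is_word (snd pq)"
      using nw by (auto simp: pq_def is_word_def n)
    moreover have "last (take (length u) w) = hd (drop (length u - 1) w)"
      using nw by (simp add: n take_Suc_conv_app_nth hd_drop_conv_nth)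
    moreover have "w = take (length u) w @ tl (drop (length u - 1) w)"
      by (simp add: n tl_drop flip: drop_Suc)
    ultimately show ?thesis by (simp add: pq_def word_sharp_eq_single)
  qed
  have "(M u \<sharp> M v) w = (\<Sum>z\<in>?S. if z = pq then if ?P then 1 else 0 else (0::'k))"
    unfolding sharp_def using term_eq by (rule sum.cong[OF refl])
  also have "\<dots> = (if ?P then 1 else 0)"
    using mem by (simp add: sum.delta[OF finite_sharp_support])
  finally show ?thesis .
qed

lemma sum_fun_apply: "(\<Sum>x\<in>A. f x) y = (\<Sum>x\<in>A. f x y)"
  by (induction A rule: infinite_finite_induct) auto

theorem theorem5p2:
  fixes u v :: "nat list" and k l :: nat
  assumes "packed u" and "length u = k" and "k \<ge> 1"
    and "packed v" and "length v = l" and "l \<ge> 1"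
  shows "(M u \<sharp> M v :: 'k::field series) =
    (\<Sum>w \<in> pp_interval (k + l - 1) (wedge u v) (vee u v). M w)"
proof
  fix w
  have ne: "u \<noteq> []" "v \<noteq> []" using assms by auto
  interpret packed_pair u v
    using assms ne by unfold_locales
  let ?I = "pp_interval (k + l - 1) (wedge u v) (vee u v)"
  \<comment> \<open>Only the summand indexed by \<open>pack w\<close> can be nonzero at
    \<open>w\<close>.\<close>
  have "(\<Sum>x\<in>?I. M x) w = (\<Sum>x\<in>?I. if pack w = x then if is_word w then 1 else 0 else (0::'k))"
    unfolding sum_fun_apply by (rule sum.cong) (auto simp: M_def)
  also have "\<dots> = (if is_word w \<and> pack w \<in> ?I then 1 else 0)"
    by (simp add: sum.delta'[OF finite_pp_interval])
  \<comment> \<open>The order sees only relative order, so \<open>pack w\<close> may be replaced by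
    \<open>w\<close> in the interval conditions.\<close>
  also have "pack w \<in> ?I \<longleftrightarrow> length w = length u + length v - 1 \<and>
      pack (take (length u) w) = u \<and> pack (drop (length u - 1) w) = v"
    using pp_between_iff[of w] assms
    by (auto simp: d_def pp_interval_def packed_pack pp_le_pack packed_eq_iff)
  finally show "(M u \<sharp> M v) w = (\<Sum>x\<in>?I. M x :: 'k series) w"
    by (simp add: M_sharp_M_apply[OF ne])
qed

end
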